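(* Let $\Bbbk$ be an algebraically closed field with $\mathrm{char}(\Bbbk)\neq 2$. Let $A=\Bbbk[x,y]$ be a Poisson algebra with $\{x,y\}=f$, where $f\in A_{\le 2}$ (that is, $f$ is a polynomial of total degree at most $2$). Then, up to a change of variables, the possibilities for $f$ are: (1) $f=0$; (2) $f=1$; (3) $f=x$; (4a) $f=x^2$; (4b) $f=x^2+1$; (5a) $f=\lambda xy$ with $\lambda\in\Bbbk^\times$; (5b) $f=\lambda xy+1$ with $\lambda\in\Bbbk^\times$. Moreover, the Poisson algebras determined by the $f$ listed above are pairwise non-isomorphic as Poisson algebras, with the exception of replacing $\lambda$ by $-\lambda$ in (5a) and in (5b).
   Context: A Poisson algebra is a commutative $\Bbbk$-algebra with a $\Bbbk$-bilinear bracket $\{-,-\}$ that is a Lie bracket and a biderivation; on $\Bbbk[x,y]$ it is determined by $\{x,y\}$. "Up to a change of variables" means up to replacing $x,y$ by another pair of polynomial generators of $\Bbbk[x,y]$, so that $A$ is isomorphic as a Poisson algebra to $\Bbbk[x,y]$ with $\{x,y\}$ equal to one of the listed polynomials. Isomorphisms of Poisson algebras are $\Bbbk$-algebra isomorphisms preserving the bracket. *)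

theory Defs
  imports "HOL-Computational_Algebra.Computational_Algebra"
begin

section \<open>Poisson algebras\<close>

locale poisson_algebra = vector_space scale
  for scale :: "'k::field \<Rightarrow> 'a::comm_ring_1 \<Rightarrow> 'a" +
  fixes bracket :: "'a \<Rightarrow> 'a \<Rightarrow> 'a"
  assumes scale_mult: "scale r (a * b) = scale r a * b"
    and bracket_linear_right: "Vector_Spaces.linear scale scale (\<lambda>b. bracket a b)"
    and bracket_linear_left: "Vector_Spaces.linear scale scale (\<lambda>a. bracket a b)"
    and bracket_self: "bracket a a = 0"
    and jacobi: "bracket a (bracket b c) + bracket b (bracket c a) + bracket c (bracket a b) = 0"
    and leibniz_right: "bracket a (b * c) = bracket a b * c + b * bracket a c"
    and leibniz_left: "bracket (a * b) c = bracket a c * b + a * bracket b c"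

definition poisson_isomorphism ::
  "('k::field \<Rightarrow> 'a::comm_ring_1 \<Rightarrow> 'a) \<Rightarrow> ('a \<Rightarrow> 'a \<Rightarrow> 'a) \<Rightarrow>
   ('k \<Rightarrow> 'b::comm_ring_1 \<Rightarrow> 'b) \<Rightarrow> ('b \<Rightarrow> 'b \<Rightarrow> 'b) \<Rightarrow> ('a \<Rightarrow> 'b) \<Rightarrow> bool" where
  "poisson_isomorphism s1 br1 s2 br2 \<phi> \<longleftrightarrow>
     Vector_Spaces.linear s1 s2 \<phi> \<and> \<phi> 1 = 1 \<and> (\<forall>a b. \<phi> (a * b) = \<phi> a * \<phi> b) \<and> bij \<phi> \<and>
     (\<forall>a b. \<phi> (br1 a b) = br2 (\<phi> a) (\<phi> b))"

definition poisson_isomorphic ::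
  "('k::field \<Rightarrow> 'a::comm_ring_1 \<Rightarrow> 'a) \<Rightarrow> ('a \<Rightarrow> 'a \<Rightarrow> 'a) \<Rightarrow>
   ('k \<Rightarrow> 'b::comm_ring_1 \<Rightarrow> 'b) \<Rightarrow> ('b \<Rightarrow> 'b \<Rightarrow> 'b) \<Rightarrow> bool" where
  "poisson_isomorphic s1 br1 s2 br2 \<longleftrightarrow> (\<exists>\<phi>. poisson_isomorphism s1 br1 s2 br2 \<phi>)"


section \<open>The polynomial ring in two variables\<close>

text \<open>
  The ring $k[x,y]$ is rendered as $k[x][y]$, the type \<open>'k poly poly\<close>: the coefficient of
  $x^i y^j$ in \<open>p\<close> is \<open>coeff (coeff p j) i\<close>.
\<close>

definition const2 :: "'k::field \<Rightarrow> 'k poly poly" where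
  "const2 c = [:[:c:]:]"

definition X2 :: "'k::field poly poly" where
  "X2 = [:[:0, 1:]:]"

definition Y2 :: "'k::field poly poly" where
  "Y2 = [:0, 1:]"

definition scale2 :: "'k::field \<Rightarrow> 'k poly poly \<Rightarrow> 'k poly poly" where
  "scale2 c p = const2 c * p"

definition total_degree_le :: "nat \<Rightarrow> 'k::field poly poly set" where
  "total_degree_le n = {p. \<forall>i j. coeff (coeff p j) i \<noteq> 0 \<longrightarrow> i + j \<le> n}"

text \<open>\<open>subst2 u v p\<close> is $p(u,v)$.\<close>

definition subst2 :: "'k::field poly poly \<Rightarrow> 'k poly poly \<Rightarrow> 'k poly poly \<Rightarrow> 'k poly poly" where
  "subst2 u v p = poly (map_poly (\<lambda>q. poly (map_poly const2 q) u) p) v"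

text \<open>
  Every element of $k[x,y]$ is $p(u,v)$ for a unique polynomial $p$, so that $k[x,y] = k[u,v]$.
\<close>

definition polynomial_generators :: "'k::field poly poly \<Rightarrow> 'k poly poly \<Rightarrow> bool" where
  "polynomial_generators u v \<longleftrightarrow> bij (subst2 u v)"

definition dX :: "'k::field poly poly \<Rightarrow> 'k poly poly" where
  "dX p = map_poly pderiv p"

definition dY :: "'k::field poly poly \<Rightarrow> 'k poly poly" where
  "dY p = pderiv p"

text \<open>
  The Poisson bracket on $k[x,y]$ determined by $\{x,y\} = f$; see \<open>poisson_bracket2_unique\<close> below.
\<close>

definition bracket2 :: "'k::field poly poly \<Rightarrow> 'k poly poly \<Rightarrow> 'k poly poly \<Rightarrow> 'k poly poly" where
  "bracket2 f a b = f * (dX a * dY b - dY a * dX b)"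

lemma dX_add: "dX (p + q) = dX p + dX q"
  by (rule poly_eqI) (simp add: dX_def coeff_map_poly pderiv_add)

lemma dX_mult: "dX (p * q) = dX p * q + p * dX q"
proof (rule poly_eqI)
  fix n
  have "pderiv (\<Sum>i\<le>n. coeff p i * coeff q (n - i)) =
      (\<Sum>i\<le>n. pderiv (coeff p i) * coeff q (n - i) + coeff p i * pderiv (coeff q (n - i)))"
    by (simp add: higher_pderiv_sum[of 1, simplified] pderiv_mult algebra_simps)
  then show "coeff (dX (p * q)) n = coeff (dX p * q + p * dX q) n"
    by (simp add: dX_def coeff_map_poly coeff_mult sum.distrib)
qed

lemma dY_add: "dY (p + q) = dY p + dY q"
  by (simp add: dY_def pderiv_add)

lemma dY_mult: "dY (p * q) = dY p * q + p * dY q"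
  by (simp add: dY_def pderiv_mult algebra_simps)

lemma dX_diff: "dX (p - q) = dX p - dX q"
  by (rule poly_eqI) (simp add: dX_def coeff_map_poly pderiv_diff)

lemma dY_diff: "dY (p - q) = dY p - dY q"
  by (simp add: dY_def pderiv_diff)

lemma dX_dY: "dX (dY p) = dY (dX p)"
proof (rule poly_eqI)
  fix n
  show "coeff (dX (dY p)) n = coeff (dY (dX p)) n"
    by (simp add: dX_def dY_def coeff_map_poly coeff_pderiv pderiv_mult
        del: of_nat_Suc)
qed

lemma d_const2: "dX (const2 c) = 0" "dY (const2 c) = 0"
  by (simp_all add: dX_def dY_def const2_def map_poly_pCons pderiv_pCons)

lemma d_X2: "dX X2 = 1" "dY X2 = 0"
  by (simp_all add: dX_def dY_def X2_def map_poly_pCons pderiv_pCons one_pCons)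

lemma d_Y2: "dX Y2 = 0" "dY Y2 = 1"
  by (simp_all add: dX_def dY_def Y2_def map_poly_pCons pderiv_pCons one_pCons)

lemma const2_hom:
  "const2 (a + b) = const2 a + const2 b" "const2 (a * b) = const2 a * const2 b" "const2 1 = 1"
  by (simp_all add: const2_def one_pCons)

lemma vector_space_scale2: "vector_space (scale2 :: 'k::field \<Rightarrow> _)"
  by unfold_locales (simp_all add: scale2_def const2_hom algebra_simps)

lemma bracket2_X2_Y2: "bracket2 f X2 Y2 = f"
  by (simp add: bracket2_def d_X2 d_Y2)

theorem poisson_algebra_bracket2: "poisson_algebra scale2 (bracket2 (f :: 'k::field poly poly))"
proof -
  interpret vector_space "scale2 :: 'k \<Rightarrow> _" by (rule vector_space_scale2)
  show ?thesis
  proof unfold_locales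
    fix a b c :: "'k poly poly"
    show "bracket2 f a (bracket2 f b c) + bracket2 f b (bracket2 f c a)
        + bracket2 f c (bracket2 f a b) = 0"
      unfolding bracket2_def
      by (simp add: dX_mult dY_mult dX_diff dY_diff dX_dY) algebra
  qed (simp_all add: bracket2_def dX_add dY_add dX_mult dY_mult scale2_def d_const2 algebra_simps)
qed

lemma poly2_induct:
  assumes "\<And>c. P (const2 c)" "P X2" "P Y2"
    "\<And>p q. P p \<Longrightarrow> P q \<Longrightarrow> P (p + q)" "\<And>p q. P p \<Longrightarrow> P q \<Longrightarrow> P (p * q)"
  shows "P (p :: 'k::field poly poly)"
proof (induction p)
  case 0
  show ?case using assms(1)[of 0] by (simp add: const2_def)
next
  case (pCons q p)
  have "P [:q:]"
  proof (induction q)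
    case 0
    show ?case using assms(1)[of 0] by (simp add: const2_def)
  next
    case (pCons c q)
    have "[:pCons c q:] = const2 c + X2 * [:q:]"
      by (simp add: const2_def X2_def)
    then show ?case using assms pCons by metis
  qed
  moreover have "pCons q p = [:q:] + Y2 * p" by (simp add: Y2_def)
  ultimately show ?case using assms pCons by metis
qed

theorem poisson_bracket2_unique:
  assumes "poisson_algebra scale2 br"
  shows "br = bracket2 (br X2 Y2 :: 'k::field poly poly)"
proof -
  interpret poisson_algebra scale2 br by fact
  have add_r: "br a (b + c) = br a b + br a c" for a b c
    using bracket_linear_right[of a] unfolding Vector_Spaces.linear_def module_hom_def module_hom_axioms_def
    by blast
  have add_l: "br (b + c) a = br b a + br c a" for a b c
    using bracket_linear_left[of a] unfolding Vector_Spaces.linear_def module_hom_def module_hom_axioms_def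
    by blast
  have sc_r: "br a (scale2 k b) = scale2 k (br a b)" for a b k
    using bracket_linear_right[of a] unfolding Vector_Spaces.linear_def module_hom_def module_hom_axioms_def
    by blast
  have one_r: "br a 1 = 0" for a using leibniz_right[of a 1 1]
    unfolding mult_1 mult_1_right by (metis add_cancel_right_right)
  have const_r: "br a (const2 c) = 0" for a c
    using sc_r[of a c 1] one_r[of a] by (simp add: scale2_def)
  have anti: "br a b = - br b a" for a b
  proof -
    have "br (a + b) (a + b) = br a b + br b a"
      unfolding add_r add_l by (simp add: bracket_self)
    then show ?thesis unfolding bracket_self by (simp add: eq_neg_iff_add_eq_0)
  qed
  have expand: "br a b = br a X2 * dX b + br a Y2 * dY b" for a b
    by (induction b rule: poly2_induct)
      (simp_all add: const_r d_const2 d_X2 d_Y2 add_r dX_add dY_add leibniz_right dX_mult dY_mult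
        algebra_simps)
  have "br a b = bracket2 (br X2 Y2) a b" for a b
  proof -
    have 1: "br a X2 = - br X2 Y2 * dY a"
      using anti[of a X2] expand[of X2 a] by (simp add: bracket_self)
    have 2: "br a Y2 = br X2 Y2 * dX a"
      using anti[of a Y2] expand[of Y2 a] anti[of Y2 X2] by (simp add: bracket_self)
    show ?thesis
      using expand[of a b] unfolding 1 2 bracket2_def by (simp add: algebra_simps)
  qed
  then show ?thesis by blast
qed


section \<open>The normal forms\<close>

definition normal_forms :: "'k::field poly poly set" where
  "normal_forms =
     {0, 1, X2, X2\<^sup>2, X2\<^sup>2 + 1}
     \<union> {const2 l * X2 * Y2 | l. l \<noteq> 0}
     \<union> {const2 l * X2 * Y2 + 1 | l. l \<noteq> 0}"

end

theory Submission
  imports Defs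
begin

text \<open>
  An algebra endomorphism of \<open>k[x,y]\<close> is a substitution \<open>p \<mapsto> p(u,v)\<close>, and by the chain rule
  the Jacobian of \<open>p(u,v)\<close> and \<open>q(u,v)\<close> is that of \<open>p\<close> and \<open>q\<close>, evaluated at \<open>(u,v)\<close>, times that of
  \<open>u\<close> and \<open>v\<close>. So the brackets given by \<open>f\<close> and \<open>g\<close> are isomorphic exactly when there are
  generators \<open>u, v\<close> with \<open>{u,v} = g(u,v)\<close> in the bracket of \<open>f\<close> (\<open>poisson_equiv_iff\<close>): isomorphism and change of variables are the same relation.
  As the Jacobian of generators is a unit, hence a constant \<open>c \<noteq> 0\<close>, this condition reads
  \<open>g(u,v) = c f\<close>.

  Existence of a normal form follows the affine classification of plane conics, where a change of
  variables also multiplies the equation by its Jacobian. Over an algebraically closed field the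
  quadratic part of \<open>f\<close> is a product of two linear forms. If these are independent, shifting them absorbs the linear part of \<open>f\<close> and leaves
  \<open>\<lambda>xy + c\<close> (\<open>normal_form_nondegenerate\<close>). If they are dependent, \<open>f\<close> becomes
  \<open>s x\<^sup>2 + a x + b y + c\<close>; a nonzero \<open>b\<close> makes \<open>f\<close> itself a coordinate, and otherwise one completes
  the square (\<open>normal_form_degenerate\<close>).

  The normal forms are told apart by their critical points, rather than by factorisation. If
  \<open>g(u,v) = c f\<close> with Jacobian \<open>c\<close>, then \<open>(u,v)\<close>, seen as a map of the plane, respects zeros and
  critical points of \<open>f\<close> and \<open>g\<close>. Moreover, at a critical point the Hessian matrix transforms by
  congruence with the Jacobian matrix, so the Hessian determinant of \<open>c f\<close>, which is \<open>c\<^sup>2\<close> times that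
  of \<open>f\<close>, is also \<open>c\<^sup>2\<close> times that of \<open>g\<close>: the two determinants agree (\<open>critical_transfer\<close>). At the
  origin \<open>\<lambda>xy\<close> and \<open>\<lambda>xy + 1\<close> have Hessian determinant \<open>- \<lambda>\<^sup>2\<close>, which determines \<open>\<lambda>\<close> up to sign.
\<close>

section \<open>Substitution and evaluation\<close>

lemma poly_map_poly_hom:
  fixes h :: "'a::comm_ring_1 \<Rightarrow> 'b::comm_ring_1"
  assumes h: "h 0 = 0" "\<And>a b. h (a + b) = h a + h b" "\<And>a b. h (a * b) = h a * h b"
  shows "poly (map_poly h (pCons a p)) v = h a + v * poly (map_poly h p) v"
    and "poly (map_poly h (p + q)) v = poly (map_poly h p) v + poly (map_poly h q) v"
    and "poly (map_poly h (p * q)) v = poly (map_poly h p) v * poly (map_poly h q) v"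
proof -
  have C: "poly (map_poly h (pCons a p)) v = h a + v * poly (map_poly h p) v" for a p
    by (simp add: map_poly_pCons h(1))
  have A: "poly (map_poly h (p + q)) v = poly (map_poly h p) v + poly (map_poly h q) v" for p q
    by (induction p q rule: poly_induct2) (simp_all add: C h algebra_simps)
  have S: "poly (map_poly h (smult a q)) v = h a * poly (map_poly h q) v" for a q
    by (induction q) (simp_all add: C h algebra_simps)
  show "poly (map_poly h (pCons a p)) v = h a + v * poly (map_poly h p) v"
    and "poly (map_poly h (p + q)) v = poly (map_poly h p) v + poly (map_poly h q) v"
    by (rule C, rule A)
  show "poly (map_poly h (p * q)) v = poly (map_poly h p) v * poly (map_poly h q) v"
    by (induction p) (simp_all add: C A S h algebra_simps)
qed

lemma const2_0 [simp]: "const2 0 = 0"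
  by (simp add: const2_def)

lemma const2_minus: "const2 (- a) = - const2 a"
  by (simp add: const2_def)

lemma const2_diff: "const2 (a - b) = const2 a - const2 b"
  by (simp add: const2_def)

lemma const2_power: "const2 (a ^ n) = const2 a ^ n"
  by (induction n) (simp_all add: const2_hom)

lemma const2_numeral: "const2 (numeral n) = numeral n"
  by (simp add: const2_def numeral_poly)

lemmas const2_simps = const2_hom const2_numeral const2_0 const2_minus const2_diff const2_power

lemma
  shows subst2_const [simp]: "subst2 u v (const2 c) = const2 c"
    and subst2_X [simp]: "subst2 u v X2 = u"
    and subst2_Y [simp]: "subst2 u v Y2 = v"
    and subst2_add [simp]: "subst2 u v (p + q) = subst2 u v p + subst2 u v q"
    and subst2_mult [simp]: "subst2 u v (p * q) = subst2 u v p * subst2 u v q"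
proof -
  define h where "h = (\<lambda>q. poly (map_poly const2 q) u)"
  have h0: "h 0 = 0" by (simp add: h_def)
  have hC: "h (pCons a p) = const2 a + u * h p" for a p
    unfolding h_def by (rule poly_map_poly_hom(1)) (simp_all add: const2_hom)
  have hA: "h (p + q) = h p + h q" for p q
    unfolding h_def by (rule poly_map_poly_hom(2)) (simp_all add: const2_hom)
  have hM: "h (p * q) = h p * h q" for p q
    unfolding h_def by (rule poly_map_poly_hom(3)) (simp_all add: const2_hom)
  have s: "subst2 u v p = poly (map_poly h p) v" for p
    by (simp add: subst2_def h_def)
  note H = poly_map_poly_hom[of h, OF h0 hA hM]
  have h1: "h 1 = 1"
    using hC[of 1 0] by (simp add: h0 const2_hom pCons_one)
  have s1: "poly (map_poly h 1) v = 1"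
    using H(1)[of 1 0 v] by (simp add: h1 pCons_one)
  show "subst2 u v (p + q) = subst2 u v p + subst2 u v q"
    "subst2 u v (p * q) = subst2 u v p * subst2 u v q"
    unfolding s by (rule H)+
  show "subst2 u v (const2 c) = const2 c" "subst2 u v X2 = u" "subst2 u v Y2 = v"
    unfolding s by (simp_all add: const2_def X2_def Y2_def H hC h0 h1 s1 pCons_one)
qed

lemma subst2_0 [simp]: "subst2 u v 0 = 0"
  using subst2_const[of u v 0] by simp

lemma subst2_1 [simp]: "subst2 u v 1 = 1"
  using subst2_const[of u v 1] by (simp add: const2_hom)

lemma subst2_minus [simp]: "subst2 u v (- p) = - subst2 u v p"
  using subst2_add[of u v p "- p"] by (simp add: eq_neg_iff_add_eq_0 add.commute)

lemma subst2_diff [simp]: "subst2 u v (p - q) = subst2 u v p - subst2 u v q"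
  using subst2_add[of u v p "- q"] by simp

lemma subst2_power [simp]: "subst2 u v (p ^ n) = subst2 u v p ^ n"
  by (induction n) simp_all

lemma subst2_subst2: "subst2 u v (subst2 p q r) = subst2 (subst2 u v p) (subst2 u v q) r"
  by (induction r rule: poly2_induct) simp_all

lemma subst2_X2_Y2 [simp]: "subst2 X2 Y2 p = p"
  by (induction p rule: poly2_induct) simp_all

definition ev :: "'k::field \<Rightarrow> 'k \<Rightarrow> 'k poly poly \<Rightarrow> 'k" where
  "ev a b p = poly (poly p [:b:]) a"

lemma ev_simps [simp]:
  "ev a b (p + q) = ev a b p + ev a b q" "ev a b (p - q) = ev a b p - ev a b q"
  "ev a b (- p) = - ev a b p" "ev a b (p * q) = ev a b p * ev a b q"
  "ev a b (p ^ n) = ev a b p ^ n" "ev a b (const2 c) = c" "ev a b X2 = a" "ev a b Y2 = b"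
  "ev a b 0 = 0" "ev a b 1 = 1" "ev a b (numeral w) = numeral w"
  by (simp_all add: ev_def const2_def X2_def Y2_def numeral_poly)

lemma ev_subst2: "ev a b (subst2 u v p) = ev (ev a b u) (ev a b v) p"
  by (induction p rule: poly2_induct) simp_all

section \<open>The Jacobian\<close>

lemma dX_minus: "dX (- p) = - dX p"
  using dX_diff[of 0 p] d_const2(1)[of 0] by simp

lemma dY_minus: "dY (- p) = - dY p"
  using dY_diff[of 0 p] d_const2(2)[of 0] by simp

lemma chain_rule:
  "dX (subst2 u v p) = subst2 u v (dX p) * dX u + subst2 u v (dY p) * dX v"
  "dY (subst2 u v p) = subst2 u v (dX p) * dY u + subst2 u v (dY p) * dY v"
  by (induction p rule: poly2_induct)
    (simp_all add: d_const2 d_X2 d_Y2 dX_add dY_add dX_mult dY_mult algebra_simps)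

abbreviation jacobian2 :: "'k::field poly poly \<Rightarrow> 'k poly poly \<Rightarrow> 'k poly poly" where
  "jacobian2 \<equiv> bracket2 1"

lemma bracket2_eq_jacobian2: "bracket2 f a b = f * jacobian2 a b"
  by (simp add: bracket2_def)

lemma jacobian2_subst2:
  "jacobian2 (subst2 u v p) (subst2 u v q) = jacobian2 u v * subst2 u v (jacobian2 p q)"
  by (simp add: bracket2_def chain_rule algebra_simps)

text \<open>
  Writing \<open>x\<close> and \<open>y\<close> as polynomials in \<open>u\<close> and \<open>v\<close>, the chain rule exhibits an inverse of the Jacobian,
  and the units of a polynomial ring over a field are the nonzero constants.
\<close>

lemma jacobian2_generators_const:
  assumes "polynomial_generators u v"
  obtains c where "c \<noteq> 0" "jacobian2 u v = const2 c"
proof -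
  have "surj (subst2 u v)"
    using assms unfolding polynomial_generators_def by (rule bij_is_surj)
  then obtain p q where "subst2 u v p = X2" "subst2 u v q = Y2"
    by (metis surjD)
  then have "jacobian2 u v * subst2 u v (jacobian2 p q) = 1"
    using jacobian2_subst2[of u v p q] by (simp add: bracket2_X2_Y2)
  then have "is_unit (jacobian2 u v)"
    by (metis dvd_triv_left)
  then obtain r where r: "jacobian2 u v = [:r:]" "is_unit r"
    by (auto simp: is_unit_poly_iff)
  then obtain c where "r = [:c:]" "c dvd 1"
    by (auto simp: is_unit_poly_iff)
  then have "c \<noteq> 0" by auto
  with r(1) \<open>r = [:c:]\<close> show thesis by (intro that[of c]) (simp_all add: const2_def)
qed

section \<open>Poisson isomorphisms are changes of variables\<close>

abbreviation poisson_equiv :: "'k::field poly poly \<Rightarrow> 'k poly poly \<Rightarrow> bool" (infix "\<approx>" 50) where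
  "f \<approx> g \<equiv> poisson_isomorphic scale2 (bracket2 f) scale2 (bracket2 g)"

lemma scale2_hom_iff:
  fixes \<phi> :: "'k::field poly poly \<Rightarrow> 'k poly poly"
  shows "Vector_Spaces.linear scale2 scale2 \<phi> \<longleftrightarrow>
    (\<forall>p q. \<phi> (p + q) = \<phi> p + \<phi> q) \<and> (\<forall>c p. \<phi> (const2 c * p) = const2 c * \<phi> p)"
  using vector_space_scale2[where 'k = 'k]
  by (simp add: Vector_Spaces.linear_def module_hom_def module_hom_axioms_def
      module_iff_vector_space scale2_def)

lemma algebra_hom_eq_subst2:
  assumes "Vector_Spaces.linear scale2 scale2 \<phi>" "\<phi> 1 = 1" "\<And>a b. \<phi> (a * b) = \<phi> a * \<phi> b"
  shows "\<phi> = subst2 (\<phi> X2) (\<phi> Y2)"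
proof
  fix p
  note lin = assms(1)[unfolded scale2_hom_iff]
  have c: "\<phi> (const2 c) = const2 c" for c
    using lin assms(2) by (metis mult_1_right)
  show "\<phi> p = subst2 (\<phi> X2) (\<phi> Y2) p"
    by (induction p rule: poly2_induct) (simp_all add: c lin assms(3))
qed

text \<open>
  Both brackets are determined by their value on a pair of generators, so a bijective substitution
  preserves them as soon as it does so on \<open>x\<close> and \<open>y\<close>.
\<close>

lemma poisson_isomorphism_iff:
  "poisson_isomorphism scale2 (bracket2 g) scale2 (bracket2 f) \<phi> \<longleftrightarrow>
    (\<exists>u v. \<phi> = subst2 u v \<and> polynomial_generators u v \<and> bracket2 f u v = subst2 u v g)"
  (is "?L \<longleftrightarrow> ?R")
proof
  assume ?L
  then have lin: "Vector_Spaces.linear scale2 scale2 \<phi>" and hom: "\<phi> 1 = 1" "\<And>a b. \<phi> (a * b) = \<phi> a * \<phi> b"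
    and "bij \<phi>" and br: "\<And>a b. \<phi> (bracket2 g a b) = bracket2 f (\<phi> a) (\<phi> b)"
    by (auto simp: poisson_isomorphism_def)
  have \<phi>: "\<phi> = subst2 (\<phi> X2) (\<phi> Y2)"
    by (rule algebra_hom_eq_subst2[OF lin hom])
  have "bracket2 f (\<phi> X2) (\<phi> Y2) = subst2 (\<phi> X2) (\<phi> Y2) g"
    using br[of X2 Y2] \<phi> by (simp add: bracket2_X2_Y2)
  with \<phi> \<open>bij \<phi>\<close> show ?R
    unfolding polynomial_generators_def by metis
next
  assume ?R
  then obtain u v where uv: "\<phi> = subst2 u v" "bij \<phi>" "bracket2 f u v = subst2 u v g"
    unfolding polynomial_generators_def by blast
  have "\<phi> (bracket2 g a b) = bracket2 f (\<phi> a) (\<phi> b)" for a b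
  proof -
    have "bracket2 f (\<phi> a) (\<phi> b) = bracket2 f u v * subst2 u v (jacobian2 a b)"
      unfolding uv(1) bracket2_eq_jacobian2[of f] jacobian2_subst2 by (simp add: mult.assoc)
    also have "\<dots> = \<phi> (bracket2 g a b)"
      unfolding uv(1,3) bracket2_eq_jacobian2[of g] by simp
    finally show ?thesis by simp
  qed
  with uv(2) show ?L
    unfolding poisson_isomorphism_def scale2_hom_iff uv(1) by simp
qed

lemma poisson_equiv_sym:
  assumes "f \<approx> g"
  shows "g \<approx> f"
proof -
  from assms obtain \<phi> where lin: "Vector_Spaces.linear scale2 scale2 \<phi>"
    and hom: "\<phi> 1 = 1" "\<And>a b. \<phi> (a * b) = \<phi> a * \<phi> b" and bij: "bij \<phi>"
    and br: "\<And>a b. \<phi> (bracket2 f a b) = bracket2 g (\<phi> a) (\<phi> b)"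
    unfolding poisson_isomorphic_def poisson_isomorphism_def by blast
  note lin' = lin[unfolded scale2_hom_iff]
  have const: "\<phi> (const2 c) = const2 c" for c
    using lin' hom(1) by (metis mult_1_right)
  have inv: "inv \<phi> (\<phi> p) = p" "\<phi> (inv \<phi> p) = p" for p
    using bij by (simp_all add: bij_is_inj bij_is_surj surj_f_inv_f)
  have eqI: "p = q" if "\<phi> p = \<phi> q" for p q
    using that inv(1) by metis
  have "poisson_isomorphism scale2 (bracket2 g) scale2 (bracket2 f) (inv \<phi>)"
    unfolding poisson_isomorphism_def scale2_hom_iff
    by (intro conjI allI bij_imp_bij_inv[OF bij]; rule eqI) (simp_all add: inv lin' hom br const)
  then show ?thesis
    unfolding poisson_isomorphic_def by blast
qed

lemma poisson_equiv_iff: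
  "f \<approx> g \<longleftrightarrow> (\<exists>u v. polynomial_generators u v \<and> bracket2 f u v = subst2 u v g)"
proof -
  have "g \<approx> f \<longleftrightarrow> (\<exists>u v. polynomial_generators u v \<and> bracket2 f u v = subst2 u v g)"
    unfolding poisson_isomorphic_def poisson_isomorphism_iff by blast
  then show ?thesis using poisson_equiv_sym by blast
qed

lemma polynomial_generatorsI:
  assumes "subst2 u v p = X2" "subst2 u v q = Y2" "subst2 p q u = X2" "subst2 p q v = Y2"
  shows "polynomial_generators u v"
  unfolding polynomial_generators_def
  by (rule o_bij[of "subst2 p q"]) (simp_all add: fun_eq_iff subst2_subst2 assms)

lemma poisson_equiv_trans:
  assumes "f \<approx> g" "g \<approx> h"
  shows "f \<approx> h"
proof -
  from assms obtain u v p q where uv: "polynomial_generators u v" "bracket2 f u v = subst2 u v g"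
    and pq: "polynomial_generators p q" "bracket2 g p q = subst2 p q h"
    unfolding poisson_equiv_iff by blast
  let ?u = "subst2 u v p" and ?v = "subst2 u v q"
  have "subst2 ?u ?v = subst2 u v \<circ> subst2 p q"
    by (simp add: fun_eq_iff subst2_subst2)
  then have "polynomial_generators ?u ?v"
    using uv(1) pq(1) unfolding polynomial_generators_def by (simp add: bij_comp)
  moreover have "bracket2 f ?u ?v = bracket2 f u v * subst2 u v (jacobian2 p q)"
    unfolding bracket2_eq_jacobian2[of f] jacobian2_subst2 by (simp add: mult.assoc)
  then have "bracket2 f ?u ?v = subst2 ?u ?v h"
    using uv(2) pq(2) unfolding bracket2_eq_jacobian2[of g] by (metis subst2_mult subst2_subst2)
  ultimately show ?thesis
    unfolding poisson_equiv_iff by blast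
qed

section \<open>Reduction of quadratic brackets to normal form\<close>

text \<open>
  The factor on the left is the Jacobian of the affine change of variables; the inverse is given
  by Cramer's rule.
\<close>

lemma poisson_equiv_affine:
  assumes "a * e - b * d \<noteq> 0"
    and "const2 (a * e - b * d) * f =
      subst2 (const2 a * X2 + const2 b * Y2 + const2 c) (const2 d * X2 + const2 e * Y2 + const2 h) g"
  shows "f \<approx> g"
proof -
  let ?u = "const2 a * X2 + const2 b * Y2 + const2 c"
  let ?v = "const2 d * X2 + const2 e * Y2 + const2 h"
  define r where "r = inverse (a * e - b * d)"
  have "r * (a * e - b * d) = 1" using assms(1) by (simp add: r_def)
  from arg_cong[OF this, of const2]
  have r: "const2 r * (const2 a * const2 e - const2 b * const2 d) = 1"
    by (simp add: const2_simps)
  let ?p = "const2 r * (const2 e * (X2 - const2 c) - const2 b * (Y2 - const2 h))"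
  let ?q = "const2 r * (const2 a * (Y2 - const2 h) - const2 d * (X2 - const2 c))"
  have "polynomial_generators ?u ?v"
  proof (rule polynomial_generatorsI)
    show "subst2 ?u ?v ?p = X2" "subst2 ?u ?v ?q = Y2" "subst2 ?p ?q ?u = X2" "subst2 ?p ?q ?v = Y2"
      by (simp; use r in algebra)+
  qed
  moreover have "bracket2 f ?u ?v = const2 (a * e - b * d) * f"
    by (simp add: bracket2_def dX_add dY_add dX_mult dY_mult d_const2 d_X2 d_Y2 const2_simps)
  ultimately show ?thesis
    unfolding poisson_equiv_iff using assms(2) by metis
qed

text \<open>
  The only change of variables of degree greater than one: \<open>f\<close> and \<open>- x / b\<close> generate \<open>k[x,y]\<close>, since
  \<open>y\<close> occurs in \<open>f\<close> linearly with an invertible coefficient, and \<open>{f, - x / b} = f\<close> because only the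
  term \<open>b y\<close> of \<open>f\<close> contributes to the Jacobian.
\<close>

lemma poisson_equiv_parabola:
  assumes "b \<noteq> 0"
  shows "const2 s * X2\<^sup>2 + const2 a * X2 + const2 b * Y2 + const2 c \<approx> X2" (is "?f \<approx> _")
proof -
  let ?v = "- const2 (inverse b) * X2"
  let ?p = "- const2 b * Y2"
  let ?q = "const2 (inverse b) * (X2 - const2 s * ?p\<^sup>2 - const2 a * ?p - const2 c)"
  have "inverse b * b = 1" using assms by simp
  from arg_cong[OF this, of const2] have r: "const2 (inverse b) * const2 b = 1"
    by (simp add: const2_simps)
  have "polynomial_generators ?f ?v"
  proof (rule polynomial_generatorsI)
    show "subst2 ?f ?v ?p = X2" "subst2 ?f ?v ?q = Y2" "subst2 ?p ?q ?f = X2" "subst2 ?p ?q ?v = Y2"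
      by (simp; use r in algebra)+
  qed
  moreover have "bracket2 ?f ?f ?v = ?f * (const2 (inverse b) * const2 b)"
    by (simp add: bracket2_def dX_add dY_add dX_mult dY_mult dX_minus dY_minus d_const2 d_X2 d_Y2
        power2_eq_square const2_simps algebra_simps)
  ultimately show ?thesis
    unfolding poisson_equiv_iff r by (metis mult_1_right subst2_X)
qed

text \<open>
  With \<open>l = \<alpha> x + \<beta> y\<close>, \<open>l' = \<gamma> x + \<delta> y\<close> and linear part \<open>m l + n l'\<close>, one has
  \<open>f = (l + n) (l' + m) + (F - m n)\<close>; the Jacobian \<open>\<Delta>\<close> of the two factors becomes the parameter \<open>\<lambda>\<close>.
  Scaling one coordinate changes the constant term and leaves \<open>\<lambda>\<close> alone.
\<close>

lemma normal_form_nondegenerate: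
  fixes \<alpha> \<beta> \<gamma> \<delta> :: "'k::field"
  assumes "\<alpha> * \<delta> - \<beta> * \<gamma> \<noteq> 0"
    and f: "f = (const2 \<alpha> * X2 + const2 \<beta> * Y2) * (const2 \<gamma> * X2 + const2 \<delta> * Y2)
      + const2 D * X2 + const2 E * Y2 + const2 F"
  shows "\<exists>g \<in> normal_forms. f \<approx> g"
proof -
  define \<Delta> where "\<Delta> = \<alpha> * \<delta> - \<beta> * \<gamma>"
  have \<Delta>: "\<Delta> \<noteq> 0" using assms(1) by (simp add: \<Delta>_def)
  define m n where "m = (D * \<delta> - E * \<gamma>) / \<Delta>" and "n = (\<alpha> * E - \<beta> * D) / \<Delta>"
  have "D = m * \<alpha> + n * \<gamma>" "E = m * \<beta> + n * \<delta>"
    using \<Delta> by (simp_all add: m_def n_def field_simps) (simp_all add: \<Delta>_def algebra_simps)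
  note DE = this
  \<comment> \<open>The constant term picks up the Jacobian as well.\<close>
  define c where "c = \<Delta> * (F - m * n)"
  have 1: "f \<approx> const2 \<Delta> * X2 * Y2 + const2 c"
    by (rule poisson_equiv_affine[of \<alpha> \<delta> \<beta> \<gamma> _ n m])
      (use assms(1) in \<open>simp_all add: f DE c_def \<Delta>_def const2_simps algebra_simps\<close>)
  show ?thesis
  proof (cases "c = 0")
    case True
    with 1 \<Delta> show ?thesis by (auto simp: normal_forms_def)
  next
    case False
    have "inverse c * c = 1" using False by simp
    from arg_cong[OF this, of const2] have r: "const2 (inverse c) * const2 c = 1"
      by (simp add: const2_simps)
    have "const2 \<Delta> * X2 * Y2 + const2 c \<approx> const2 \<Delta> * X2 * Y2 + 1"
    proof (rule poisson_equiv_affine[of "inverse c" 1 0 0 _ 0 0])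
      show "inverse c * 1 - 0 * 0 \<noteq> 0" using False by simp
    qed (use r in \<open>simp add: const2_simps algebra_simps\<close>)
    then have "f \<approx> const2 \<Delta> * X2 * Y2 + 1"
      using 1 poisson_equiv_trans by blast
    with \<Delta> show ?thesis by (auto simp: normal_forms_def)
  qed
qed

lemma normal_form_degenerate:
  fixes s a b c :: "'k::alg_closed_field"
  assumes two: "(2::'k) \<noteq> 0"
    and f: "f = const2 s * X2\<^sup>2 + const2 a * X2 + const2 b * Y2 + const2 c"
  shows "\<exists>g \<in> normal_forms. f \<approx> g"
proof -
  have NF: "0 \<in> normal_forms" "1 \<in> normal_forms" "X2 \<in> normal_forms" "X2\<^sup>2 \<in> normal_forms"
    "X2\<^sup>2 + 1 \<in> (normal_forms :: 'k poly poly set)"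
    by (simp_all add: normal_forms_def)
  have inv: "const2 (inverse t) * const2 t = 1" if "t \<noteq> 0" for t :: 'k
    using that by (simp flip: const2_hom)
  consider (parabola) "b \<noteq> 0" | (square) "b = 0" "s \<noteq> 0" | (linear) "b = 0" "s = 0" "a \<noteq> 0"
    | (const) "b = 0" "s = 0" "a = 0" "c \<noteq> 0" | (zero) "b = 0" "s = 0" "a = 0" "c = 0"
    by blast
  then show ?thesis
  proof cases
    case parabola
    with NF f poisson_equiv_parabola show ?thesis by blast
  next
    case square
    define n where "n = a / (2 * s)"
    define k where "k = c - s * n\<^sup>2"
    have ac: "a = 2 * s * n" "c = k + s * n\<^sup>2"
      using square two by (simp_all add: n_def k_def)
    have 1: "f \<approx> const2 s * X2\<^sup>2 + const2 k"
      by (rule poisson_equiv_affine[of 1 1 0 0 _ n 0])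
        (simp_all add: f square ac const2_simps power2_eq_square algebra_simps mult_2)
    show ?thesis
    proof (cases "k = 0")
      case True
      have "const2 s * X2\<^sup>2 + const2 k \<approx> X2\<^sup>2"
        by (rule poisson_equiv_affine[of 1 "inverse s" 0 0 _ 0 0])
          (use True square inv[of s] in \<open>simp_all add: const2_simps mult.assoc[symmetric]\<close>)
      with 1 NF show ?thesis using poisson_equiv_trans by blast
    next
      case False
      \<comment> \<open>\<open>s x\<^sup>2 + k = k ((t x)\<^sup>2 + 1)\<close>, and scaling \<open>y\<close> by \<open>1 / (t k)\<close> turns the Jacobian into \<open>1 / k\<close>.\<close>
      obtain t where t: "t\<^sup>2 = s / k"
        using nth_root_exists[of 2 "s / k"] by auto
      have "t \<noteq> 0" using t square False by auto
      then have "t * (inverse (t * k)) * (s * 1) = t\<^sup>2" "t * inverse (t * k) * k = 1"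
        using False t by (simp_all add: field_simps)
      from this[THEN arg_cong, of const2]
      have eqs: "const2 t * const2 (inverse (t * k)) * const2 s = const2 t ^ 2"
        "const2 t * const2 (inverse (t * k)) * const2 k = 1"
        by (simp_all only: const2_simps mult_1_right)
      have "const2 s * X2\<^sup>2 + const2 k \<approx> X2\<^sup>2 + 1"
      proof (rule poisson_equiv_affine[of t "inverse (t * k)" 0 0 _ 0 0])
        show "t * inverse (t * k) - 0 * 0 \<noteq> 0" using \<open>t \<noteq> 0\<close> False by simp
        show "const2 (t * inverse (t * k) - 0 * 0) * (const2 s * X2\<^sup>2 + const2 k) =
          subst2 (const2 t * X2 + const2 0 * Y2 + const2 0)
            (const2 0 * X2 + const2 (inverse (t * k)) * Y2 + const2 0) (X2\<^sup>2 + 1)"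
          unfolding const2_diff const2_hom(2) using eqs by simp algebra
      qed
      with 1 NF show ?thesis using poisson_equiv_trans by blast
    qed
  next
    case linear
    have "f \<approx> X2"
      by (rule poisson_equiv_affine[of 1 "inverse a" 0 0 _ "inverse a * c" 0])
        (use linear inv[of a] in \<open>simp_all add: f const2_simps algebra_simps\<close>)
    with NF show ?thesis by blast
  next
    case const
    have "f \<approx> 1"
      by (rule poisson_equiv_affine[of 1 "inverse c" 0 0 _ 0 0])
        (use const inv[of c] in \<open>simp_all add: f\<close>)
    with NF show ?thesis by blast
  next
    case zero
    have "f \<approx> 0"
      by (rule poisson_equiv_affine[of 1 1 0 0 _ 0 0]) (simp_all add: f zero)
    with NF show ?thesis by blast
  qed
qed

lemma binary_quadratic_form_splits:
  fixes A B C :: "'k::alg_closed_field"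
  obtains \<alpha> \<beta> \<gamma> \<delta> where "A = \<alpha> * \<gamma>" "B = \<alpha> * \<delta> + \<beta> * \<gamma>" "C = \<beta> * \<delta>"
proof (cases "A = 0")
  case True
  with that[where \<alpha> = 0 and \<beta> = 1 and \<gamma> = B and \<delta> = C] show thesis by simp
next
  case False
  then obtain r where r: "poly [:C, B, A:] r = 0"
    using alg_closed_imp_poly_has_root[of "[:C, B, A:]"] by auto
  show thesis
  proof (rule that[where \<alpha> = 1 and \<beta> = "- r" and \<gamma> = A and \<delta> = "B + A * r"])
    show "C = - r * (B + A * r)"
      using r by (simp add: algebra_simps eq_neg_iff_add_eq_0)
  qed (simp_all add: algebra_simps)
qed

lemma normal_form_exists:
  fixes f :: "'k::alg_closed_field poly poly"
  assumes two: "(2::'k) \<noteq> 0"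
    and f: "f = const2 A * X2\<^sup>2 + const2 B * X2 * Y2 + const2 C * Y2\<^sup>2
      + const2 D * X2 + const2 E * Y2 + const2 F"
  shows "\<exists>g \<in> normal_forms. f \<approx> g"
proof -
  obtain \<alpha> \<beta> \<gamma> \<delta> where ABC: "A = \<alpha> * \<gamma>" "B = \<alpha> * \<delta> + \<beta> * \<gamma>" "C = \<beta> * \<delta>"
    by (rule binary_quadratic_form_splits)
  show ?thesis
  proof (cases "\<alpha> * \<delta> - \<beta> * \<gamma> = 0")
    case False
    then show ?thesis
      by (rule normal_form_nondegenerate[where D = D and E = E and F = F])
        (simp add: f ABC const2_simps power2_eq_square algebra_simps)
  next
    case True
    \<comment> \<open>Two proportional factors give a multiple of the square of one nonzero form \<open>p x + q y\<close>;
      a vanishing quadratic part is the case \<open>s = 0\<close>.\<close>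
    have "\<exists>p q s. (p \<noteq> 0 \<or> q \<noteq> 0) \<and> A = s * p\<^sup>2 \<and> B = 2 * s * p * q \<and> C = s * q\<^sup>2"
    proof (cases "\<alpha> = 0 \<and> \<beta> = 0")
      case True
      then show ?thesis using ABC by (intro exI[of _ 1] exI[of _ 0]) simp
    next
      case False
      define s where "s = (if \<alpha> = 0 then \<delta> / \<beta> else \<gamma> / \<alpha>)"
      have "\<gamma> = s * \<alpha>" "\<delta> = s * \<beta>"
        using True False by (auto simp: s_def field_simps)
      then show ?thesis using False ABC
        by (intro exI[of _ \<alpha>] exI[of _ \<beta>] exI[of _ s])
          (simp add: power2_eq_square algebra_simps)
    qed
    then obtain p q s where pq: "p \<noteq> 0 \<or> q \<noteq> 0" "A = s * p\<^sup>2" "B = 2 * s * p * q" "C = s * q\<^sup>2"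
      by blast
    \<comment> \<open>Complete \<open>p x + q y\<close> to linear coordinates of determinant one.\<close>
    obtain p' q' where det: "p * q' - q * p' = 1"
    proof (cases "p = 0")
      case True
      with pq(1) that[of 0 "- inverse q"] that[of "- inverse q" 0] show thesis by simp
    next
      case False
      with that[of "inverse p" 0] that[of 0 "inverse p"] show thesis by simp
    qed
    \<comment> \<open>Coefficients of the linear part of \<open>f\<close> in the new coordinates.\<close>
    define a b where "a = D * q' - E * p'" and "b = E * p - D * q"
    have DE: "D = a * p + b * p'" "E = a * q + b * q'"
      unfolding a_def b_def using det by algebra+
    have "f \<approx> const2 s * X2\<^sup>2 + const2 a * X2 + const2 b * Y2 + const2 F"
      by (rule poisson_equiv_affine[of p q' q p' _ 0 0, unfolded det])
        (simp_all add: f pq(2-4) DE const2_simps power2_eq_square algebra_simps mult_2)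
    moreover obtain g where "g \<in> normal_forms"
      "const2 s * X2\<^sup>2 + const2 a * X2 + const2 b * Y2 + const2 F \<approx> g"
      using normal_form_degenerate[OF two refl] by blast
    ultimately show ?thesis using poisson_equiv_trans by blast
  qed
qed

lemma total_degree_le_2_expand:
  assumes "f \<in> total_degree_le 2"
  obtains A B C D E F where "f = const2 A * X2\<^sup>2 + const2 B * X2 * Y2 + const2 C * Y2\<^sup>2
      + const2 D * X2 + const2 E * Y2 + const2 F"
proof -
  define co where "co = (\<lambda>i j. coeff (coeff f j) i)"
  have co: "co i j = 0" if "i + j > 2" for i j
    using assms that unfolding total_degree_le_def co_def by fastforce
  have "f = [:[:co 0 0, co 1 0, co 2 0:], [:co 0 1, co 1 1:], [:co 0 2:]:]" (is "f = ?g")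
  proof (intro poly_eqI)
    fix i j
    have "coeff (coeff f j) i = co i j" by (simp add: co_def)
    also have "\<dots> = coeff (coeff ?g j) i"
      using co by (auto simp: coeff_pCons numeral_2_eq_2 split: nat.splits)
    finally show "coeff (coeff f j) i = coeff (coeff ?g j) i" .
  qed
  also have "\<dots> = const2 (co 2 0) * X2\<^sup>2 + const2 (co 1 1) * X2 * Y2 + const2 (co 0 2) * Y2\<^sup>2
      + const2 (co 1 0) * X2 + const2 (co 0 1) * Y2 + const2 (co 0 0)"
    by (simp add: const2_def X2_def Y2_def power2_eq_square)
  finally show thesis by (rule that)
qed

section \<open>Critical points\<close>

definition critical :: "'k::field poly poly \<Rightarrow> 'k \<Rightarrow> 'k \<Rightarrow> bool" where
  "critical f a b \<longleftrightarrow> ev a b (dX f) = 0 \<and> ev a b (dY f) = 0"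

definition hessian :: "'k::field poly poly \<Rightarrow> 'k poly poly" where
  "hessian f = dX (dX f) * dY (dY f) - dX (dY f) * dY (dX f)"

text \<open>
  Only the zero set of \<open>f\<close> is respected by isomorphisms, as \<open>f\<close> may be rescaled; hence a truth value
  in place of the critical value.
\<close>

definition critical_data :: "'k::field poly poly \<Rightarrow> (bool \<times> 'k) set" where
  "critical_data f = {(ev a b f = 0, ev a b (hessian f)) | a b. critical f a b}"

text \<open>
  This separates the constants from \<open>x\<^sup>2\<close> and \<open>x\<^sup>2 + 1\<close>, which have the same critical data as \<open>0\<close> and \<open>1\<close>.
\<close>

definition all_critical :: "'k::field poly poly \<Rightarrow> bool" where
  "all_critical f \<longleftrightarrow> (\<forall>a b. critical f a b)"

text \<open>
  The point \<open>(a', b')\<close> is the image of \<open>(a, b)\<close> under the map \<open>(u,v)\<close>. The gradient of \<open>g(u,v) = c f\<close>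
  is that of \<open>g\<close> times the Jacobian matrix, which is invertible. Differentiating once more gives
  the congruent Hessian matrix plus terms containing first derivatives of \<open>g\<close>, which vanish at a
  critical point.
\<close>

lemma critical_transfer:
  assumes "f \<approx> g"
  obtains a' b' where "critical f a b \<longleftrightarrow> critical g a' b'" "ev a b f = 0 \<longleftrightarrow> ev a' b' g = 0"
    "critical f a b \<Longrightarrow> ev a b (hessian f) = ev a' b' (hessian g)"
proof -
  from assms obtain u v where uv: "polynomial_generators u v" "bracket2 f u v = subst2 u v g"
    unfolding poisson_equiv_iff by blast
  from uv(1) obtain c where c: "c \<noteq> 0" "jacobian2 u v = const2 c"
    by (rule jacobian2_generators_const)
  have eq: "subst2 u v g = const2 c * f"
    using uv(2) c(2) bracket2_eq_jacobian2[of f u v] by (simp add: mult.commute)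
  define a' b' where "a' = ev a b u" and "b' = ev a b v"
  define P Q R S where "P = ev a b (dX u)" and "Q = ev a b (dX v)"
    and "R = ev a b (dY u)" and "S = ev a b (dY v)"
  have ev': "ev a b (subst2 u v p) = ev a' b' p" for p
    by (simp add: ev_subst2 a'_def b'_def)
  have det: "P * S - R * Q = c"
    using arg_cong[OF c(2), of "ev a b"]
    by (simp add: bracket2_def P_def Q_def R_def S_def algebra_simps)
  have val: "c * ev a b f = ev a' b' g"
    using arg_cong[OF eq, of "ev a b"] by (simp add: ev')
  have fX: "const2 c * dX f = dX (subst2 u v g)" and fY: "const2 c * dY f = dY (subst2 u v g)"
    by (simp_all add: eq dX_mult dY_mult d_const2)
  have gX: "c * ev a b (dX f) = ev a' b' (dX g) * P + ev a' b' (dY g) * Q"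
    using arg_cong[OF fX, of "ev a b"] by (simp add: chain_rule ev' P_def Q_def)
  have gY: "c * ev a b (dY f) = ev a' b' (dX g) * R + ev a' b' (dY g) * S"
    using arg_cong[OF fY, of "ev a b"] by (simp add: chain_rule ev' R_def S_def)
  have crit: "critical f a b \<longleftrightarrow> critical g a' b'"
  proof
    assume "critical f a b"
    then have "ev a' b' (dX g) * P + ev a' b' (dY g) * Q = 0"
        "ev a' b' (dX g) * R + ev a' b' (dY g) * S = 0"
      using gX gY by (simp_all add: critical_def)
    then have "ev a' b' (dX g) * c = 0" "ev a' b' (dY g) * c = 0"
      unfolding det[symmetric] by algebra+
    with c(1) show "critical g a' b'" by (simp add: critical_def)
  next
    assume "critical g a' b'"
    with gX gY c(1) show "critical f a b" by (simp add: critical_def)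
  qed
  have hess: "ev a b (hessian f) = ev a' b' (hessian g)" if "critical f a b"
  proof -
    have g0: "ev a' b' (dX g) = 0" "ev a' b' (dY g) = 0"
      using that crit by (simp_all add: critical_def)
    define K L M N where "K = ev a' b' (dX (dX g))" and "L = ev a' b' (dX (dY g))"
      and "M = ev a' b' (dY (dX g))" and "N = ev a' b' (dY (dY g))"
    have sym: "L = M" by (simp add: L_def M_def dX_dY)
    note defs = P_def Q_def R_def S_def K_def L_def M_def N_def
    have second: "const2 c * dX (dX f) = dX (dX (subst2 u v g))"
      "const2 c * dX (dY f) = dX (dY (subst2 u v g))"
      "const2 c * dY (dX f) = dY (dX (subst2 u v g))"
      "const2 c * dY (dY f) = dY (dY (subst2 u v g))"
      by (simp_all add: eq dX_mult dY_mult d_const2)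
    have XX: "c * ev a b (dX (dX f)) = (K * P + M * Q) * P + (L * P + N * Q) * Q"
      using arg_cong[OF second(1), of "ev a b"]
      by (simp add: chain_rule dX_add dY_add dX_mult dY_mult ev' g0 flip: defs)
    have XY: "c * ev a b (dX (dY f)) = (K * P + M * Q) * R + (L * P + N * Q) * S"
      using arg_cong[OF second(2), of "ev a b"]
      by (simp add: chain_rule dX_add dY_add dX_mult dY_mult ev' g0 flip: defs)
    have YX: "c * ev a b (dY (dX f)) = (K * R + M * S) * P + (L * R + N * S) * Q"
      using arg_cong[OF second(3), of "ev a b"]
      by (simp add: chain_rule dX_add dY_add dX_mult dY_mult ev' g0 flip: defs)
    have YY: "c * ev a b (dY (dY f)) = (K * R + M * S) * R + (L * R + N * S) * S"
      using arg_cong[OF second(4), of "ev a b"]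
      by (simp add: chain_rule dX_add dY_add dX_mult dY_mult ev' g0 flip: defs)
    have "c^2 * ev a b (hessian f) =
        (c * ev a b (dX (dX f))) * (c * ev a b (dY (dY f)))
        - (c * ev a b (dX (dY f))) * (c * ev a b (dY (dX f)))"
      by (simp add: hessian_def power2_eq_square algebra_simps)
    also have "\<dots> = (P * S - R * Q)^2 * (K * N - L * M)"
      unfolding XX XY YX YY sym by algebra
    also have "\<dots> = c^2 * ev a' b' (hessian g)"
      unfolding det by (simp add: hessian_def K_def L_def M_def N_def)
    finally show ?thesis using c(1) by simp
  qed
  show thesis
    using that[of a' b'] crit val hess c(1) by (metis mult_eq_0_iff)
qed

lemma critical_data_invariant:
  assumes "f \<approx> g"
  shows "critical_data f = critical_data g" "all_critical f = all_critical g"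
proof -
  have "critical_data f \<subseteq> critical_data g \<and> (all_critical g \<longrightarrow> all_critical f)" if equiv: "f \<approx> g"
    for f g :: "'a poly poly"
  proof (intro conjI impI subsetI)
    fix d assume "d \<in> critical_data f"
    then obtain a b where ab: "d = (ev a b f = 0, ev a b (hessian f))" "critical f a b"
      by (auto simp: critical_data_def)
    obtain a' b' where "critical f a b \<longleftrightarrow> critical g a' b'" "ev a b f = 0 \<longleftrightarrow> ev a' b' g = 0"
      "critical f a b \<Longrightarrow> ev a b (hessian f) = ev a' b' (hessian g)"
      using critical_transfer[OF equiv, where a = a and b = b] by blast
    with ab show "d \<in> critical_data g"
      unfolding critical_data_def by blast
  next
    assume "all_critical g"
    then show "all_critical f"
      unfolding all_critical_def by (meson critical_transfer[OF equiv])
  qed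
  then show "critical_data f = critical_data g" "all_critical f = all_critical g"
    using assms poisson_equiv_sym[OF assms] by blast+
qed


section \<open>Critical points of the normal forms\<close>

lemma d_0_1: "dX 0 = 0" "dY 0 = 0" "dX 1 = 0" "dY 1 = 0"
  using d_const2[of 0] d_const2[of 1] by (simp_all add: const2_hom)

lemmas d_simps = d_0_1 dX_add dY_add dX_mult dY_mult d_const2 d_X2 d_Y2 power2_eq_square

lemma invariants_0: "critical_data 0 = {(True, 0)}" "all_critical 0"
  by (simp_all add: critical_data_def all_critical_def critical_def hessian_def d_simps)

lemma invariants_1: "critical_data 1 = {(False, 0)}" "all_critical 1"
  by (simp_all add: critical_data_def all_critical_def critical_def hessian_def d_simps)

lemma invariants_X: "critical_data X2 = {}"
  by (simp add: critical_data_def critical_def d_simps)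

lemma invariants_XX:
  assumes "(2::'k::field) \<noteq> 0"
  shows "critical_data (X2\<^sup>2 :: 'k poly poly) = {(True, 0)}"
    and "critical_data (X2\<^sup>2 + 1 :: 'k poly poly) = {(False, 0)}"
    and "\<not> all_critical (X2\<^sup>2 :: 'k poly poly)" "\<not> all_critical (X2\<^sup>2 + 1 :: 'k poly poly)"
proof -
  have crit: "critical (X2\<^sup>2) a b \<longleftrightarrow> a = 0" "critical (X2\<^sup>2 + 1) a b \<longleftrightarrow> a = 0" for a b :: 'k
    by (simp_all add: critical_def d_simps assms)
  show "critical_data (X2\<^sup>2 :: 'k poly poly) = {(True, 0)}"
    "critical_data (X2\<^sup>2 + 1 :: 'k poly poly) = {(False, 0)}"
    unfolding critical_data_def crit by (simp_all add: hessian_def d_simps)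
  have "\<exists>a::'k. a \<noteq> 0" by (rule exI[of _ 1]) simp
  then show "\<not> all_critical (X2\<^sup>2 :: 'k poly poly)" "\<not> all_critical (X2\<^sup>2 + 1 :: 'k poly poly)"
    unfolding all_critical_def crit by simp_all
qed

lemma invariants_XY:
  assumes "l \<noteq> 0"
  shows "critical_data (const2 l * X2 * Y2) = {(True, - l\<^sup>2)}"
    "critical_data (const2 l * X2 * Y2 + 1) = {(False, - l\<^sup>2)}"
proof -
  have crit: "critical (const2 l * X2 * Y2) a b \<longleftrightarrow> a = 0 \<and> b = 0"
    "critical (const2 l * X2 * Y2 + 1) a b \<longleftrightarrow> a = 0 \<and> b = 0" for a b
    using assms by (auto simp: critical_def d_simps)
  show "critical_data (const2 l * X2 * Y2) = {(True, - l\<^sup>2)}"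
    "critical_data (const2 l * X2 * Y2 + 1) = {(False, - l\<^sup>2)}"
    unfolding critical_data_def crit by (simp_all add: hessian_def d_simps)
qed

text \<open>
  The substitution is \<open>u = - y\<close>, \<open>v = x\<close>, of Jacobian one; the plain swap of \<open>x\<close> and \<open>y\<close> would also
  change the sign of the constant term.
\<close>

lemma poisson_equiv_negate:
  "const2 l * X2 * Y2 \<approx> const2 (- l) * X2 * Y2"
  "const2 l * X2 * Y2 + 1 \<approx> const2 (- l) * X2 * Y2 + 1"
  by (rule poisson_equiv_affine[of 0 0 "- 1" 1 _ 0 0]; simp add: const2_simps algebra_simps)+

lemma poisson_equiv_refl: "f \<approx> f"
  by (rule poisson_equiv_affine[of 1 1 0 0 _ 0 0]) (simp_all add: const2_simps)

lemma normal_forms_cases: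
  assumes "g \<in> normal_forms"
  obtains "g = 0" | "g = 1" | "g = X2" | "g = X2\<^sup>2" | "g = X2\<^sup>2 + 1"
    | l where "l \<noteq> 0" "g = const2 l * X2 * Y2" | l where "l \<noteq> 0" "g = const2 l * X2 * Y2 + 1"
  using assms unfolding normal_forms_def by blast

lemma normal_forms_equiv_iff:
  fixes g h :: "'k::field poly poly"
  assumes two: "(2::'k) \<noteq> 0" and "g \<in> normal_forms" "h \<in> normal_forms"
  shows "g \<approx> h \<longleftrightarrow> g = h \<or>
      (\<exists>l. l \<noteq> 0 \<and> g = const2 l * X2 * Y2 \<and> h = const2 (- l) * X2 * Y2) \<or>
      (\<exists>l. l \<noteq> 0 \<and> g = const2 l * X2 * Y2 + 1 \<and> h = const2 (- l) * X2 * Y2 + 1)"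
    (is "_ \<longleftrightarrow> ?R")
proof
  assume "g \<approx> h"
  note inv = critical_data_invariant[OF this]
  note I = invariants_0 invariants_1 invariants_X invariants_XX[OF two]
  from assms(2) show ?R
  proof (cases rule: normal_forms_cases)
    case (6 l)
    from assms(3) show ?thesis
      by (cases rule: normal_forms_cases; insert inv 6; auto simp: I invariants_XY power2_eq_iff)
  next
    case (7 l)
    from assms(3) show ?thesis
      by (cases rule: normal_forms_cases; insert inv 7; auto simp: I invariants_XY power2_eq_iff)
  qed (use assms(3) in \<open>cases rule: normal_forms_cases; insert inv; simp add: I invariants_XY\<close>)+
next
  assume ?R
  then show "g \<approx> h"
    by (elim disjE exE conjE) (simp_all only: poisson_equiv_refl poisson_equiv_negate)
qed

theorem theorem3p1:
  assumes "CHAR('k::alg_closed_field) \<noteq> 2"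
  shows
    "(\<forall>(f :: 'k poly poly) br.
        poisson_algebra scale2 br \<and> br X2 Y2 = f \<and> f \<in> total_degree_le 2 \<longrightarrow>
        (\<exists>g \<in> normal_forms. \<exists>u v.
           polynomial_generators u v \<and> br u v = subst2 u v g \<and>
           poisson_isomorphic scale2 br scale2 (bracket2 g)))
     \<and>
     (\<forall>g \<in> normal_forms. \<forall>h \<in> (normal_forms :: 'k poly poly set).
        poisson_isomorphic scale2 (bracket2 g) scale2 (bracket2 h) \<longleftrightarrow>
          g = h \<or>
          (\<exists>l. l \<noteq> 0 \<and> g = const2 l * X2 * Y2 \<and> h = const2 (- l) * X2 * Y2) \<or>
          (\<exists>l. l \<noteq> 0 \<and> g = const2 l * X2 * Y2 + 1 \<and> h = const2 (- l) * X2 * Y2 + 1))"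
proof -
  have two: "(2::'k) \<noteq> 0"
  proof
    assume "(2::'k) = 0"
    then have "of_nat 2 = (0::'k)" by simp
    then have "CHAR('k) dvd 2" unfolding of_nat_eq_0_iff_char_dvd .
    moreover have "CHAR('k) \<noteq> 1"
      using of_nat_CHAR[where 'a = 'k] by fastforce
    ultimately show False
      using assms by (metis prime_nat_iff two_is_prime_nat)
  qed
  have "\<exists>g \<in> normal_forms. \<exists>u v. polynomial_generators u v \<and> br u v = subst2 u v g \<and>
      poisson_isomorphic scale2 br scale2 (bracket2 g)"
    if "poisson_algebra scale2 br" and deg: "br X2 Y2 \<in> total_degree_le 2"
    for br :: "'k poly poly \<Rightarrow> 'k poly poly \<Rightarrow> 'k poly poly"
  proof -
    define f where "f = br X2 Y2"
    have br: "br = bracket2 f"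
      unfolding f_def by (rule poisson_bracket2_unique) fact
    obtain g where g: "g \<in> normal_forms" "f \<approx> g"
      using normal_form_exists[OF two] total_degree_le_2_expand[OF deg] unfolding f_def by metis
    from g(2) obtain u v where "polynomial_generators u v" "bracket2 f u v = subst2 u v g"
      unfolding poisson_equiv_iff by blast
    with g show ?thesis unfolding br by blast
  qed
  then show ?thesis
    using normal_forms_equiv_iff[OF two] by blast
qed

end
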